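(* Suppose that $\Gamma$ is a consistent set of s-formulas in $\mathcal{F}_2$, $\phi$ is an s-formula in $\mathcal{F}_2$, and every frame that satisfies $\Gamma$ satisfies $\phi$. Then there is a derivation of $\phi$ from $\Gamma$ using the rules (I), (W), (HS), and (N) of the deductive system for $\mathcal{F}_2$.
   Context: Fix an infinite (possibly uncountable) set $\Sigma$ of propositional variables. The fragment $\mathcal{F}_2$ consists of all formal expressions (s-formulas) $A\prec Y$ (strict implication) and $A\not\prec Y$ (strict nonimplication), where $A$ is a nonempty finite conjunction of propositional variables and $Y$ is a single propositional variable; $\prec$ and $\not\prec$ are two formal symbols. For conjunctions of variables $A$ and $B$, $A\land B$ denotes the conjunction obtained by inserting $\land$ between $A$ and $B$ (parenthesization is disregarded, so a conjunction amounts to a finite list of variables). A valuation is a function $w:\Sigma\to\{T,F\}$, extended in the usual way to conjunctions. A frame is a nonempty set of valuations. A frame $R$ satisfies $A \prec Y$ if for every $w\in R$, $w(A)=F$ or $w(Y)=T$. A frame $R$ satisfies $A\not\prec Y$ if there is some $w\in R$ with $w(A)=T$ and $w(Y)=F$. A frame satisfies a set $\Gamma$ of s-formulas if it satisfies every member. $\Gamma$ is consistent if some frame satisfies it. The deductive system for $\mathcal{F}_2$ consists of the following rule schemes, where $A,B$ range over nonempty conjunctions of propositional variables (except that $B$ may be empty in (HS)) and $X,Y,Z$ over propositional variables: - (I) Deduce $X\prec X$ (no premises). - (W) From $A\prec Y$, deduce $B\prec Y$, where $B$ is any conjunction such that every conjunct of $A$ is also a conjunct of $B$. - (HS) From $X\land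 B\prec Y$ and $A\prec X$, deduce $A\land B\prec Y$. - (N) From $A\not\prec X$, $A\land Z\prec X$, and $A\prec Y$ for each conjunct $Y$ of $B$, deduce $B\not\prec Z$. A derivation of $\phi$ from $\Gamma$ is a finite derivation of $\phi$ from members of $\Gamma$ using these rules. *)

theory Defs
  imports Main
begin

text \<open>
  The set of propositional variables is a type \<open>'a\<close>. Parenthesization of conjunctions is
  disregarded, so a conjunction is the list of its conjuncts and \<open>A \<and> B\<close> is \<open>A @ B\<close>.
  The datatype also contains expressions with an empty antecedent; these are excluded
  by the set \<open>F2\<close> of s-formulas and by the side conditions of the rules.
\<close>

type_synonym 'a conj = "'a list"

datatype 'a sform =
    SImp "'a conj" 'a  (infix "\<prec>" 60)
  | SNimp "'a conj" 'a  (infix "\<not>\<prec>" 60)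

definition F2 :: "'a sform set" where
  "F2 = {A \<prec> Y | A Y. A \<noteq> []} \<union> {A \<not>\<prec> Y | A Y. A \<noteq> []}"

type_synonym 'a valuation = "'a \<Rightarrow> bool"

definition conj_val :: "'a valuation \<Rightarrow> 'a conj \<Rightarrow> bool" where
  "conj_val w A \<longleftrightarrow> (\<forall>X \<in> set A. w X)"

definition is_frame :: "'a valuation set \<Rightarrow> bool" where
  "is_frame R \<longleftrightarrow> R \<noteq> {}"

fun satisfies :: "'a valuation set \<Rightarrow> 'a sform \<Rightarrow> bool" where
  "satisfies R (A \<prec> Y) \<longleftrightarrow> (\<forall>w \<in> R. \<not> conj_val w A \<or> w Y)"
| "satisfies R (A \<not>\<prec> Y) \<longleftrightarrow> (\<exists>w \<in> R. conj_val w A \<and> \<not> w Y)"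

definition satisfies_set :: "'a valuation set \<Rightarrow> 'a sform set \<Rightarrow> bool" where
  "satisfies_set R \<Gamma> \<longleftrightarrow> (\<forall>\<phi> \<in> \<Gamma>. satisfies R \<phi>)"

definition consistent :: "'a sform set \<Rightarrow> bool" where
  "consistent \<Gamma> \<longleftrightarrow> (\<exists>R. is_frame R \<and> satisfies_set R \<Gamma>)"

inductive derivable :: "'a sform set \<Rightarrow> 'a sform \<Rightarrow> bool" (infix "\<turnstile>" 50)
  for \<Gamma> :: "'a sform set" where
  Prem: "\<phi> \<in> \<Gamma> \<Longrightarrow> \<Gamma> \<turnstile> \<phi>"
| I: "\<Gamma> \<turnstile> [X] \<prec> X"
| W: "\<Gamma> \<turnstile> A \<prec> Y \<Longrightarrow> A \<noteq> [] \<Longrightarrow> B \<noteq> [] \<Longrightarrow> set A \<subseteq> set B \<Longrightarrow> \<Gamma> \<turnstile> B \<prec> Y"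
| HS: "\<Gamma> \<turnstile> [X] @ B \<prec> Y \<Longrightarrow> \<Gamma> \<turnstile> A \<prec> X \<Longrightarrow> A \<noteq> [] \<Longrightarrow> \<Gamma> \<turnstile> A @ B \<prec> Y"
| N: "\<Gamma> \<turnstile> A \<not>\<prec> X \<Longrightarrow> \<Gamma> \<turnstile> A @ [Z] \<prec> X \<Longrightarrow> (\<And>Y. Y \<in> set B \<Longrightarrow> \<Gamma> \<turnstile> A \<prec> Y)
    \<Longrightarrow> A \<noteq> [] \<Longrightarrow> B \<noteq> [] \<Longrightarrow> \<Gamma> \<turnstile> B \<not>\<prec> Z"

lemma derivable_in_F2:
  assumes "\<Gamma> \<turnstile> \<phi>" and "\<Gamma> \<subseteq> F2"
  shows "\<phi> \<in> F2"
  using assms by (induction rule: derivable.induct) (auto simp: F2_def)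

lemma derivable_sound:
  assumes "\<Gamma> \<turnstile> \<phi>" and "satisfies_set R \<Gamma>"
  shows "satisfies R \<phi>"
  using assms(1)
proof (induction rule: derivable.induct)
  case (Prem \<phi>)
  then show ?case using assms(2) by (simp add: satisfies_set_def)
next
  case (I X)
  then show ?case by (simp add: conj_val_def)
next
  case (W A Y B)
  have "conj_val w A" if "conj_val w B" for w
    using that W.hyps(4) by (auto simp: conj_val_def)
  then show ?case using W.IH by auto
next
  case (HS X B Y A)
  have "conj_val w ([X] @ B)" if "w \<in> R" "conj_val w (A @ B)" for w
    using that HS.IH(2) by (auto simp: conj_val_def)
  then show ?case using HS.IH(1) by auto
next
  case (N A X Z B)
  obtain w where w: "w \<in> R" "conj_val w A" "\<not> w X" using N.IH(1) by auto
  have "w Y" if "Y \<in> set B" for Y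
    using N.IH(3)[OF that] w by auto
  then have "conj_val w B" by (simp add: conj_val_def)
  moreover have "\<not> w Z"
  proof
    assume "w Z"
    then have "conj_val w (A @ [Z])" using w(2) by (auto simp: conj_val_def)
    then show False using N.IH(2) w by auto
  qed
  ultimately show ?case using w(1) by auto
qed

end

theory Submission
  imports Defs
begin

text \<open>
  Let \<open>w\<^sub>A\<close> make exactly those \<open>Y\<close> true for which \<open>A \<prec> Y\<close> is derivable; by cut it satisfies all
  implications in \<open>\<Gamma>\<close>. The set of all valuations satisfying these implications is a model of the
  consistent set \<open>\<Gamma>\<close>, and \<open>w\<^sub>A\<close> refutes \<open>A \<prec> Y\<close> there unless it is derivable. For \<open>B \<not>\<prec> Z\<close>, remove
  from that frame every witness of \<open>B \<not>\<prec> Z\<close>. Some \<open>A \<not>\<prec> X\<close> in \<open>\<Gamma>\<close> must then fail, so each valuation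
  witnessing it was removed; looking at \<open>w\<^sub>A\<close> and at the valuation of \<open>A \<and> Z\<close> yields the premises of (N).
\<close>

text \<open>(HS) replaces the conjuncts of \<open>C\<close> by \<open>A\<close> one at a time. The
  induction varies \<open>B\<close> because each replacement adds a copy of \<open>A\<close> to the
  side context.\<close>

lemma derivable_cut:
  assumes "\<Gamma> \<turnstile> C @ B \<prec> Y" "\<And>X. X \<in> set C \<Longrightarrow> \<Gamma> \<turnstile> A \<prec> X" "A \<noteq> []" "C @ B \<noteq> []"
  shows "\<Gamma> \<turnstile> A @ B \<prec> Y"
  using assms
proof (induction C arbitrary: B)
  case Nil
  from Nil.prems(1) show ?case
    by (rule derivable.W) (use Nil.prems in auto)
next
  case (Cons X C)
  have "\<Gamma> \<turnstile> A @ (C @ B) \<prec> Y"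
    using Cons.prems derivable.HS[of \<Gamma> X "C @ B" Y A] by simp
  \<comment> \<open>(W) compares only sets of conjuncts, so it serves as exchange here and contracts
    the two copies of \<open>A\<close> at the end.\<close>
  then have "\<Gamma> \<turnstile> C @ (A @ B) \<prec> Y"
    by (rule derivable.W) (use \<open>A \<noteq> []\<close> in auto)
  then have "\<Gamma> \<turnstile> A @ (A @ B) \<prec> Y"
    by (rule Cons.IH) (use Cons.prems in auto)
  then show ?case
    by (rule derivable.W) (use \<open>A \<noteq> []\<close> in auto)
qed

definition implication_models :: "'a sform set \<Rightarrow> 'a valuation set" where
  "implication_models \<Gamma> = {w. \<forall>A Y. A \<prec> Y \<in> \<Gamma> \<longrightarrow> conj_val w A \<longrightarrow> w Y}"

definition canonical_val :: "'a sform set \<Rightarrow> 'a conj \<Rightarrow> 'a valuation" where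
  "canonical_val \<Gamma> A Y \<longleftrightarrow> \<Gamma> \<turnstile> A \<prec> Y"

lemma canonical_val_conj: "conj_val (canonical_val \<Gamma> A) A"
proof -
  have "\<Gamma> \<turnstile> A \<prec> X" if "X \<in> set A" for X
    using derivable.I[of \<Gamma> X] by (rule derivable.W) (use that in auto)
  then show ?thesis by (simp add: conj_val_def canonical_val_def)
qed

lemma canonical_val_in_models:
  assumes "\<Gamma> \<subseteq> F2" "A \<noteq> []"
  shows "canonical_val \<Gamma> A \<in> implication_models \<Gamma>"
proof -
  have "\<Gamma> \<turnstile> A \<prec> Y" if C: "C \<prec> Y \<in> \<Gamma>" and A: "\<forall>X\<in>set C. \<Gamma> \<turnstile> A \<prec> X" for C Y
  proof -
    have "C \<noteq> []" using C assms(1) by (auto simp: F2_def)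
    then show ?thesis
      using derivable_cut[of \<Gamma> C "[]" Y A] derivable.Prem[OF C] A assms(2) by simp
  qed
  then show ?thesis
    unfolding implication_models_def conj_val_def canonical_val_def by blast
qed

lemma subset_implication_models:
  assumes "satisfies_set R \<Gamma>"
  shows "R \<subseteq> implication_models \<Gamma>"
proof -
  have "w Y" if "w \<in> R" "A \<prec> Y \<in> \<Gamma>" "conj_val w A" for w A Y
    using bspec[OF assms[unfolded satisfies_set_def] that(2)] that(1,3) by auto
  then show ?thesis unfolding implication_models_def by blast
qed

text \<open>Implications are universal and pass to subsets, so only the nonimplications have to be
  checked.\<close>

lemma satisfies_set_subset_modelsI:
  assumes "R \<subseteq> implication_models \<Gamma>" "\<And>A X. A \<not>\<prec> X \<in> \<Gamma> \<Longrightarrow> satisfies R (A \<not>\<prec> X)"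
  shows "satisfies_set R \<Gamma>"
  unfolding satisfies_set_def
proof
  fix \<psi> assume "\<psi> \<in> \<Gamma>"
  then show "satisfies R \<psi>"
    using assms by (cases \<psi>) (auto simp: implication_models_def)
qed

text \<open>Nonimplications are existential: their witnesses in any model of \<Gamma> persist in
  this larger frame.\<close>

lemma implication_models_model:
  assumes "consistent \<Gamma>"
  shows "is_frame (implication_models \<Gamma>)" "satisfies_set (implication_models \<Gamma>) \<Gamma>"
proof -
  obtain R where R: "is_frame R" "satisfies_set R \<Gamma>"
    using assms by (auto simp: consistent_def)
  note sub = subset_implication_models[OF R(2)]
  show "is_frame (implication_models \<Gamma>)"
    using R(1) sub by (auto simp: is_frame_def)
  show "satisfies_set (implication_models \<Gamma>) \<Gamma>"
  proof (rule satisfies_set_subset_modelsI)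
    fix A X assume "A \<not>\<prec> X \<in> \<Gamma>"
    then have "satisfies R (A \<not>\<prec> X)" using R(2) unfolding satisfies_set_def by blast
    then show "satisfies (implication_models \<Gamma>) (A \<not>\<prec> X)" using sub by auto
  qed simp
qed

lemma complete_SImp:
  assumes "\<Gamma> \<subseteq> F2" "A \<noteq> []" "satisfies (implication_models \<Gamma>) (A \<prec> Y)"
  shows "\<Gamma> \<turnstile> A \<prec> Y"
  using assms canonical_val_in_models[OF assms(1,2)] canonical_val_conj[of \<Gamma> A]
  by (auto simp: canonical_val_def)

lemma complete_SNimp:
  assumes F2: "\<Gamma> \<subseteq> F2" and con: "consistent \<Gamma>" and "B \<noteq> []"
    and ent: "\<And>R. is_frame R \<Longrightarrow> satisfies_set R \<Gamma> \<Longrightarrow> satisfies R (B \<not>\<prec> Z)"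
  shows "\<Gamma> \<turnstile> B \<not>\<prec> Z"
proof -
  define R where "R = {w \<in> implication_models \<Gamma>. \<not> (conj_val w B \<and> \<not> w Z)}"
  \<comment> \<open>This valuation makes \<open>Z\<close> true, so it survives the removal and keeps
    \<open>R\<close> nonempty.\<close>
  have "(\<lambda>_. True) \<in> R" by (simp add: R_def implication_models_def)
  then have "is_frame R" by (auto simp: is_frame_def)
  moreover have "\<not> satisfies R (B \<not>\<prec> Z)" by (auto simp: R_def)
  ultimately have "\<not> satisfies_set R \<Gamma>" using ent by blast
  moreover have "R \<subseteq> implication_models \<Gamma>" by (auto simp: R_def)
  ultimately obtain A X where AX: "A \<not>\<prec> X \<in> \<Gamma>" and "\<not> satisfies R (A \<not>\<prec> X)"
    using satisfies_set_subset_modelsI by blast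
  \<comment> \<open>Such a \<open>w\<close> cannot lie in \<open>R\<close>, where it would witness
    \<open>A \<not>\<prec> X\<close>; hence it was removed.\<close>
  then have wit: "conj_val w B \<and> \<not> w Z"
    if "w \<in> implication_models \<Gamma>" "conj_val w A" "\<not> w X" for w
    using that by (auto simp: R_def)
  have "A \<noteq> []" using AX F2 by (auto simp: F2_def)
  \<comment> \<open>This is where consistency enters: by soundness, a model of \<Gamma> would
    satisfy both \<open>A \<prec> X\<close> and \<open>A \<not>\<prec> X\<close>. Hence
    \<open>wit\<close> applies to the valuation of \<open>A\<close>.\<close>
  have "\<not> \<Gamma> \<turnstile> A \<prec> X"
  proof
    note model = implication_models_model(2)[OF con]
    assume "\<Gamma> \<turnstile> A \<prec> X"
    then have "satisfies (implication_models \<Gamma>) (A \<prec> X)"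
      using model by (rule derivable_sound)
    moreover have "satisfies (implication_models \<Gamma>) (A \<not>\<prec> X)"
      using model AX unfolding satisfies_set_def by blast
    ultimately show False by auto
  qed
  then have "conj_val (canonical_val \<Gamma> A) B"
    using wit[OF canonical_val_in_models[OF F2 \<open>A \<noteq> []\<close>] canonical_val_conj]
    by (simp add: canonical_val_def)
  then have B: "\<Gamma> \<turnstile> A \<prec> Y" if "Y \<in> set B" for Y
    using that by (simp add: conj_val_def canonical_val_def)
  have "conj_val (canonical_val \<Gamma> (A @ [Z])) (A @ [Z])" by (rule canonical_val_conj)
  then have "conj_val (canonical_val \<Gamma> (A @ [Z])) A" "canonical_val \<Gamma> (A @ [Z]) Z"
    by (auto simp: conj_val_def)
  \<comment> \<open>Were \<open>X\<close> false here, \<open>wit\<close> would make \<open>Z\<close>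
    false, but this valuation makes \<open>Z\<close> true.\<close>
  then have "\<Gamma> \<turnstile> A @ [Z] \<prec> X"
    using wit[of "canonical_val \<Gamma> (A @ [Z])"] canonical_val_in_models[OF F2, of "A @ [Z]"]
    by (auto simp: canonical_val_def)
  with derivable.Prem[OF AX] show ?thesis
    using B \<open>A \<noteq> []\<close> \<open>B \<noteq> []\<close> by (rule derivable.N)
qed

theorem theorem17:
  fixes \<Gamma> :: "'a sform set" and \<phi> :: "'a sform"
  assumes "infinite (UNIV :: 'a set)"
    and "\<Gamma> \<subseteq> F2"
    and "consistent \<Gamma>"
    and "\<phi> \<in> F2"
    and "\<And>R. is_frame R \<Longrightarrow> satisfies_set R \<Gamma> \<Longrightarrow> satisfies R \<phi>"
  shows "\<Gamma> \<turnstile> \<phi>"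
proof (cases \<phi>)
  case (SImp A Y)
  then have "A \<noteq> []" using assms(4) by (auto simp: F2_def)
  moreover have "satisfies (implication_models \<Gamma>) (A \<prec> Y)"
    using assms(5)[OF implication_models_model[OF assms(3)]] by (simp only: SImp)
  ultimately show ?thesis
    unfolding SImp by (rule complete_SImp[OF assms(2)])
next
  case (SNimp B Z)
  then have "B \<noteq> []" using assms(4) by (auto simp: F2_def)
  then show ?thesis
    unfolding SNimp by (rule complete_SNimp[OF assms(2,3)]) (use assms(5) SNimp in simp)
qed

end
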